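(* Assume variable returns to scale, i.e. $L=U=1$. Let $(x_j,y_j)\in\mathbb{R}_{\ge 0}^m\times\mathbb{R}_{\ge 0}^s$ ($j=1,\dots,n$) be input-output data with $x_j\ne0$, $y_j\ne 0$, let $o\in\{1,\dots,n\}$, and let $g=(g^-,-g^+)$ with $g^-\in\mathbb{R}_{\ge 0}^m$, $g^+\in\mathbb{R}_{\ge 0}^s$ be a direction vector that is not affected by translation of the data, i.e. when the data are translated to $x'_{ij}=x_{ij}+a_i$, $y'_{rj}=y_{rj}+b_r$ for all $i,r,j$ with arbitrary real constants $a_i,b_r$, the direction vector remains $g'=g$. Then the super-efficiency measures $\rho_o^F$ and $\rho_o^L$ are translation invariant: for all real constants $a_1,\dots,a_m,b_1,\dots,b_s$, the value $\rho_o^F(g)$ computed from $(x'_j,y'_j)_j$ equals $\rho_o^F(g)$ computed from $(x_j,y_j)_j$, and likewise the value(s) of $\rho_o^L(g)$ computed from $(x'_j,y'_j)_j$ coincide with the value(s) computed from $(x_j,y_j)_j$.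
   Context: $\mathrm{DMU}_j$ denotes the decision making unit with inputs $x_j=(x_{1j},\dots,x_{mj})$ and outputs $y_j=(y_{1j},\dots,y_{sj})$; $\mathrm{DMU}_o$ is under evaluation and $J=\{1,\dots,n\}\setminus\{o\}$ is the reference set. Given data (possibly with negative entries after translation) and a direction $g$, consider the constraints, with $L=U=1$, $$\sum_{j\in J}\lambda_j x_{ij}\le x_{io}+\tau_i^- g_i^-\ (i=1,\dots,m),\qquad \sum_{j\in J}\lambda_j y_{rj}\ge y_{ro}-\tau_r^+ g_r^+\ (r=1,\dots,s),$$ $$L\le\sum_{j\in J}\lambda_j\le U,\qquad \lambda_j,\tau_i^-,\tau_r^+\ge 0\ \text{ for all } j,i,r.\qquad ( * )$$ - Fractional GDSE measure: $\rho_o^F(g)$ is the minimum (infimum) of $\dfrac{1+\frac1m\sum_i\tau_i^-}{1-\frac1s\sum_r\tau_r^+}$ over points satisfying $( * )$ with positive denominator ($\frac1s\sum_r\tau_r^+<1$); it is $+\infty$ if there are no such points. - Linear GDSE measure: the Linear GDSE model minimizes $\frac1m\sum_i\tau_i^-+\frac1s\sum_r\tau_r^+$ subject to $( * )$. Given an optimal solution $(\lambda_j^*,\tau_i^{-*},\tau_r^{+*})$ of it with $\frac1s\sum_r\tau_r^{+*}<1$, one sets $$\rho_o^L(g)=\Bigl[1+\tfrac1m\sum_{i=1}^m\tau_i^{-*}\Bigr]\Bigl[1-\tfrac1s\sum_{r=1}^s\tau_r^{+*}\Bigr]^{-1}.$$ Since the optimal solution may be non-unique, "the value(s) of $\rho_o^L(g)$"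 means the set of all numbers obtained in this way from optimal solutions. *)

theory Defs
  imports "HOL-Analysis.Analysis"
begin

text \<open>
  The numbers of units, inputs and outputs are the cardinalities of the index types
  \<open>'n\<close>, \<open>'m\<close>, \<open>'s\<close>. The unit under evaluation is \<open>k\<close> and the reference set \<open>J\<close> is \<open>- {k}\<close>.
  A direction \<open>g = (g\<^sup>-, -g\<^sup>+)\<close> is given by its two parts \<open>gm = g\<^sup>-\<close> and \<open>gp = g\<^sup>+\<close>.
  The intensities are a function on all units, of which only the values on \<open>- {k}\<close> are used.
\<close>

definition gdse_feasible ::
  "real \<Rightarrow> real \<Rightarrow> ('n::finite \<Rightarrow> real^'m) \<Rightarrow> ('n \<Rightarrow> real^'s) \<Rightarrow> 'n \<Rightarrow> real^'m \<Rightarrow> real^'s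
    \<Rightarrow> ('n \<Rightarrow> real) \<Rightarrow> real^'m \<Rightarrow> real^'s \<Rightarrow> bool"
  where "gdse_feasible L U X Y k gm gp lam tm tp \<longleftrightarrow>
    (\<forall>i. (\<Sum>j\<in>- {k}. lam j * X j $ i) \<le> X k $ i + tm $ i * gm $ i) \<and>
    (\<forall>r. (\<Sum>j\<in>- {k}. lam j * Y j $ r) \<ge> Y k $ r - tp $ r * gp $ r) \<and>
    L \<le> (\<Sum>j\<in>- {k}. lam j) \<and> (\<Sum>j\<in>- {k}. lam j) \<le> U \<and>
    (\<forall>j\<in>- {k}. lam j \<ge> 0) \<and> (\<forall>i. tm $ i \<ge> 0) \<and> (\<forall>r. tp $ r \<ge> 0)"

definition vec_mean :: "real^'m::finite \<Rightarrow> real"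
  where "vec_mean t = 1 / real CARD('m) * (\<Sum>i\<in>UNIV. t $ i)"

text \<open>The infimum is taken in the extended reals, where \<open>Inf {} = \<infinity>\<close>.\<close>

definition rho_F ::
  "real \<Rightarrow> real \<Rightarrow> ('n::finite \<Rightarrow> real^'m) \<Rightarrow> ('n \<Rightarrow> real^'s) \<Rightarrow> 'n \<Rightarrow> real^'m \<Rightarrow> real^'s \<Rightarrow> ereal"
  where "rho_F L U X Y k gm gp =
    Inf {ereal ((1 + vec_mean tm) / (1 - vec_mean tp)) | lam tm tp.
      gdse_feasible L U X Y k gm gp lam tm tp \<and> vec_mean tp < 1}"

definition linear_gdse_optimal ::
  "real \<Rightarrow> real \<Rightarrow> ('n::finite \<Rightarrow> real^'m) \<Rightarrow> ('n \<Rightarrow> real^'s) \<Rightarrow> 'n \<Rightarrow> real^'m \<Rightarrow> real^'s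
    \<Rightarrow> ('n \<Rightarrow> real) \<Rightarrow> real^'m \<Rightarrow> real^'s \<Rightarrow> bool"
  where "linear_gdse_optimal L U X Y k gm gp lam tm tp \<longleftrightarrow>
    gdse_feasible L U X Y k gm gp lam tm tp \<and>
    (\<forall>lam' tm' tp'. gdse_feasible L U X Y k gm gp lam' tm' tp' \<longrightarrow>
      vec_mean tm + vec_mean tp \<le> vec_mean tm' + vec_mean tp')"

text \<open>Optimal solutions need not be unique, so the linear measure is the set of all its values.\<close>

definition rho_L ::
  "real \<Rightarrow> real \<Rightarrow> ('n::finite \<Rightarrow> real^'m) \<Rightarrow> ('n \<Rightarrow> real^'s) \<Rightarrow> 'n \<Rightarrow> real^'m \<Rightarrow> real^'s \<Rightarrow> real set"
  where "rho_L L U X Y k gm gp =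
    {(1 + vec_mean tm) * inverse (1 - vec_mean tp) | lam tm tp.
      linear_gdse_optimal L U X Y k gm gp lam tm tp \<and> vec_mean tp < 1}"

definition translate :: "real^'m \<Rightarrow> ('n \<Rightarrow> real^'m) \<Rightarrow> 'n \<Rightarrow> real^'m"
  where "translate a X = (\<lambda>j. \<chi> i. X j $ i + a $ i)"

end

theory Submission
  imports Defs
begin

text \<open>Under variable returns to scale the intensities sum to 1, so a translation adds the same
  constant \<open>a $ i\<close> or \<open>b $ r\<close> to both sides of each input or output
  constraint (\<open>sum_weighted_translate\<close>), while the slack terms involve only the
  direction, which stays fixed. Hence the feasible set is unchanged
  (\<open>gdse_feasible_translate\<close>), and both measures depend on the data only through that
  set.\<close>

lemma sum_weighted_translate:
  fixes X :: "'n \<Rightarrow> real^'m"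
  assumes "(\<Sum>j\<in>J. lam j) = 1"
  shows "(\<Sum>j\<in>J. lam j * translate a X j $ i) = (\<Sum>j\<in>J. lam j * X j $ i) + a $ i"
proof -
  have "(\<Sum>j\<in>J. lam j * translate a X j $ i) = (\<Sum>j\<in>J. lam j * X j $ i) + (\<Sum>j\<in>J. lam j) * a $ i"
    by (simp add: translate_def distrib_left sum.distrib sum_distrib_right)
  with assms show ?thesis by simp
qed

text \<open>Equating the predicates themselves lets the infimum, the optimality condition and the
  value set all transfer by plain rewriting.\<close>

lemma gdse_feasible_translate:
  "gdse_feasible 1 1 (translate a X) (translate b Y) k gm gp = gdse_feasible 1 1 X Y k gm gp"
proof (intro ext)
  fix lam tm tp
  show "gdse_feasible 1 1 (translate a X) (translate b Y) k gm gp lam tm tp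
    = gdse_feasible 1 1 X Y k gm gp lam tm tp"
  \<comment> \<open>The added constants cancel only when the intensities sum to 1; otherwise the
    bounds \<open>L = U = 1\<close> make both sides false.\<close>
  proof (cases "(\<Sum>j\<in>- {k}. lam j) = 1")
    case True
    have "translate a X k $ i = X k $ i + a $ i" "translate b Y k $ r = Y k $ r + b $ r" for i r
      by (simp_all add: translate_def)
    then show ?thesis
      by (simp add: gdse_feasible_def sum_weighted_translate[OF True] algebra_simps)
  next
    case False
    then show ?thesis
      by (auto simp: gdse_feasible_def)
  qed
qed

lemma rho_F_translate:
  "rho_F 1 1 (translate a X) (translate b Y) k gm gp = rho_F 1 1 X Y k gm gp"
  by (simp add: rho_F_def gdse_feasible_translate)

lemma rho_L_translate:
  "rho_L 1 1 (translate a X) (translate b Y) k gm gp = rho_L 1 1 X Y k gm gp"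
  by (simp add: rho_L_def linear_gdse_optimal_def gdse_feasible_translate)

theorem theorem4p3p4:
  fixes X :: "'n::finite \<Rightarrow> real^'m::finite"
    and Y :: "'n \<Rightarrow> real^'s::finite"
    and k :: 'n
    and gm :: "('n \<Rightarrow> real^'m) \<Rightarrow> ('n \<Rightarrow> real^'s) \<Rightarrow> real^'m"
    and gp :: "('n \<Rightarrow> real^'m) \<Rightarrow> ('n \<Rightarrow> real^'s) \<Rightarrow> real^'s"
    and a :: "real^'m" and b :: "real^'s"
  assumes "\<And>j i. X j $ i \<ge> 0" and "\<And>j r. Y j $ r \<ge> 0"
    and "\<And>j. X j \<noteq> 0" and "\<And>j. Y j \<noteq> 0"
    and "\<And>i. gm X Y $ i \<ge> 0" and "\<And>r. gp X Y $ r \<ge> 0"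
    and "\<And>a' b'. gm (translate a' X) (translate b' Y) = gm X Y"
    and "\<And>a' b'. gp (translate a' X) (translate b' Y) = gp X Y"
  defines "X' \<equiv> translate a X" and "Y' \<equiv> translate b Y"
  shows "rho_F 1 1 X' Y' k (gm X' Y') (gp X' Y') = rho_F 1 1 X Y k (gm X Y) (gp X Y) \<and>
         rho_L 1 1 X' Y' k (gm X' Y') (gp X' Y') = rho_L 1 1 X Y k (gm X Y) (gp X Y)"
  \<comment> \<open>The direction is a function of the data; its invariance replaces it by the
    original one, so that the lemmas for a fixed direction apply.\<close>
  unfolding X'_def Y'_def assms(7,8) by (simp add: rho_F_translate rho_L_translate)

end
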